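(* Let $(V,\omega)$ be a $2n$-dimensional real symplectic vector space and let $\mathcal{F}$ be a set of pairwise Poisson commuting positive-definite quadratic forms on $V$, i.e. $\{f,g\}=0$ for all $f,g\in\mathcal{F}$. Then there exists a symplectic basis $\{x_1,\dots,x_n,y_1,\dots,y_n\}$ of $V$ which diagonalizes each element of $\mathcal{F}$ in the sense of Williamson's theorem: for each $f\in\mathcal{F}$ there are real numbers $\mu_1,\dots,\mu_n>0$ (depending on $f$) such that $f\big(\sum_{j=1}^n(s_jx_j+t_jy_j)\big)=\sum_{j=1}^n\mu_j(s_j^2+t_j^2)$ for all $s_j,t_j\in\mathbb{R}$.
   Context: A basis $\{x_1,\dots,x_n,y_1,\dots,y_n\}$ of $V$ is symplectic if $\omega(x_j,y_k)=\delta_{jk}$ and $\omega(x_j,x_k)=\omega(y_j,y_k)=0$ for all $j,k$. The Poisson bracket of smooth functions on $V$ is the standard one, $\{f,g\}=\omega(X_f,X_g)$, where the Hamiltonian vector field $X_f$ is defined by $\omega(X_f,\cdot)=df$ (the overall sign convention is immaterial). *)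

theory Defs
  imports "HOL-Analysis.Analysis"
begin

text \<open>The dimension is stated through an explicit finite basis, because the library's \<open>dim\<close>
  is \<open>0\<close> on infinite-dimensional spaces.\<close>

definition symplectic_vector_space :: "nat \<Rightarrow> ('a::real_vector \<Rightarrow> 'a \<Rightarrow> real) \<Rightarrow> bool" where
  "symplectic_vector_space n \<omega> \<longleftrightarrow>
     (\<exists>B::'a set. finite B \<and> independent B \<and> span B = UNIV \<and> card B = 2 * n) \<and>
     bilinear \<omega> \<and>
     (\<forall>v. \<omega> v v = 0) \<and>
     (\<forall>v. (\<forall>w. \<omega> v w = 0) \<longrightarrow> v = 0)"

definition quadratic_form :: "('a::real_vector \<Rightarrow> real) \<Rightarrow> bool" where
  "quadratic_form q \<longleftrightarrow>
     (\<exists>b. bilinear b \<and> (\<forall>v w. b v w = b w v) \<and> (\<forall>v. q v = b v v))"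

definition positive_definite :: "('a::real_vector \<Rightarrow> real) \<Rightarrow> bool" where
  "positive_definite q \<longleftrightarrow> (\<forall>v. v \<noteq> 0 \<longrightarrow> q v > 0)"

text \<open>The differential \<open>df\<close> at \<open>v\<close> applied to \<open>w\<close>, taken along the line through \<open>v\<close> in direction
  \<open>w\<close>. A finite-dimensional real vector space carries no canonical norm, so this avoids choosing
  one; for differentiable functions on a normed space it is the Frechet derivative, as the lemma
  below shows.\<close>

definition differential :: "('a::real_vector \<Rightarrow> real) \<Rightarrow> 'a \<Rightarrow> 'a \<Rightarrow> real" where
  "differential f v w = deriv (\<lambda>t::real. f (v + t *\<^sub>R w)) 0"

lemma differential_eq_has_derivative:
  fixes f :: "'a::real_normed_vector \<Rightarrow> real"
  assumes "(f has_derivative f') (at v)"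
  shows "differential f v = f'"
proof
  fix w
  have "((\<lambda>t::real. v + t *\<^sub>R w) has_derivative (\<lambda>t. t *\<^sub>R w)) (at 0)"
    by (auto intro!: derivative_eq_intros)
  moreover have "(f has_derivative f') (at (v + 0 *\<^sub>R w))"
    using assms by simp
  ultimately have "((\<lambda>t::real. f (v + t *\<^sub>R w)) has_derivative (\<lambda>t. f' (t *\<^sub>R w))) (at 0)"
    by (rule has_derivative_compose)
  moreover have "(\<lambda>t. f' (t *\<^sub>R w)) = (*) (f' w)"
    using has_derivative_linear[OF assms] by (auto simp: linear_scale)
  ultimately have "((\<lambda>t::real. f (v + t *\<^sub>R w)) has_field_derivative f' w) (at 0)"
    by (simp add: has_field_derivative_def)
  then show "differential f v w = f' w"
    unfolding differential_def by (rule DERIV_imp_deriv)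
qed

definition hamiltonian_vector_field ::
    "('a::real_vector \<Rightarrow> 'a \<Rightarrow> real) \<Rightarrow> ('a \<Rightarrow> real) \<Rightarrow> 'a \<Rightarrow> 'a" where
  "hamiltonian_vector_field \<omega> f v = (THE x. \<forall>w. \<omega> x w = differential f v w)"

definition poisson_bracket ::
    "('a::real_vector \<Rightarrow> 'a \<Rightarrow> real) \<Rightarrow> ('a \<Rightarrow> real) \<Rightarrow> ('a \<Rightarrow> real) \<Rightarrow> 'a \<Rightarrow> real" where
  "poisson_bracket \<omega> f g v =
     \<omega> (hamiltonian_vector_field \<omega> f v) (hamiltonian_vector_field \<omega> g v)"

text \<open>The cardinality condition says that the listed \<open>2n\<close> vectors are distinct.\<close>

definition symplectic_basis ::
    "nat \<Rightarrow> ('a::real_vector \<Rightarrow> 'a \<Rightarrow> real) \<Rightarrow> (nat \<Rightarrow> 'a) \<Rightarrow> (nat \<Rightarrow> 'a) \<Rightarrow> bool" where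
  "symplectic_basis n \<omega> x y \<longleftrightarrow>
     independent (x ` {1..n} \<union> y ` {1..n}) \<and>
     span (x ` {1..n} \<union> y ` {1..n}) = UNIV \<and>
     card (x ` {1..n} \<union> y ` {1..n}) = 2 * n \<and>
     (\<forall>j\<in>{1..n}. \<forall>k\<in>{1..n}.
        \<omega> (x j) (y k) = (if j = k then 1 else 0) \<and> \<omega> (x j) (x k) = 0 \<and> \<omega> (y j) (y k) = 0)"

end

theory Submission
  imports Defs "HOL-Computational_Algebra.Fundamental_Theorem_Algebra"
begin

text \<open>Each form \<open>f\<close> with polarisation \<open>b f\<close> has a linear Hamiltonian field
  \<open>2 A f\<close>, where \<open>\<omega>(A f v, w) = b f v w\<close>, and the Poisson bracket of \<open>f\<close> and \<open>g\<close>
  vanishes iff \<open>A f\<close> and \<open>A g\<close> commute. Fixing \<open>h \<in> F\<close>, the operators \<open>A h \<circ> A f\<close> are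
  symmetric for the inner product \<open>b h\<close> and commute, so they have a common eigenvector \<open>v\<close>; the
  plane spanned by \<open>v\<close> and \<open>A h v\<close> is symplectic and invariant, and the forms are
  simultaneously diagonal on it. Its symplectic complement is again invariant, so planes can be split off
  until the space is exhausted.\<close>

section \<open>Polynomials in an operator and eigenvectors of symmetric operators\<close>

definition poly_apply :: "('a::real_vector \<Rightarrow> 'a) \<Rightarrow> real poly \<Rightarrow> 'a \<Rightarrow> 'a" where
  "poly_apply T p v = (\<Sum>i\<le>degree p. coeff p i *\<^sub>R (T ^^ i) v)"

lemma poly_apply_altdef:
  assumes "degree p \<le> N"
  shows "poly_apply T p v = (\<Sum>i\<le>N. coeff p i *\<^sub>R (T ^^ i) v)"
  unfolding poly_apply_def
  by (rule sum.mono_neutral_left) (use assms in \<open>auto simp: coeff_eq_0\<close>)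

lemma poly_apply_0 [simp]: "poly_apply T 0 v = 0"
  by (simp add: poly_apply_def)

lemma poly_apply_add: "poly_apply T (p + q) v = poly_apply T p v + poly_apply T q v"
proof -
  define N where "N = max (degree p) (degree q)"
  have "degree p \<le> N" "degree q \<le> N" "degree (p + q) \<le> N"
    using degree_add_le_max[of p q] by (auto simp: N_def)
  then show ?thesis
    by (simp add: poly_apply_altdef[of _ N] scaleR_add_left sum.distrib)
qed

lemma poly_apply_smult: "poly_apply T (smult c p) v = c *\<^sub>R poly_apply T p v"
  by (simp add: poly_apply_altdef[of _ "degree p"] scaleR_sum_right)

lemma poly_apply_diff: "poly_apply T (p - q) v = poly_apply T p v - poly_apply T q v"
  using poly_apply_add[of T "p - q" q v] by simp

text \<open>\<open>pCons 0 p\<close> is X times \<open>p\<close>, so every iterate gains one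
  application of \<open>T\<close>.\<close>

lemma poly_apply_pCons_0:
  assumes "linear T"
  shows "poly_apply T (pCons 0 p) v = T (poly_apply T p v)"
proof -
  have "degree (pCons 0 p) \<le> Suc (degree p)"
    by (rule degree_pCons_le)
  then show ?thesis
    by (simp add: poly_apply_altdef[of _ "Suc (degree p)"] sum.atMost_Suc_shift poly_apply_def
        linear_sum[OF assms] linear_scale[OF assms] del: sum.atMost_Suc)
qed

lemma poly_apply_mem:
  assumes "subspace W" "\<And>w. w \<in> W \<Longrightarrow> T w \<in> W" "v \<in> W"
  shows "poly_apply T p v \<in> W"
proof -
  have "(T ^^ i) v \<in> W" for i
    using assms by (induction i) auto
  then show ?thesis
    unfolding poly_apply_def by (intro subspace_sum subspace_scale assms(1))
qed

text \<open>The first \<open>card B + 1\<close> iterates of \<open>v\<close> are too many to be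
  independent; a linear relation among them supplies the coefficients.\<close>

lemma ex_annihilating_poly:
  fixes T :: "'a::real_vector \<Rightarrow> 'a"
  assumes "finite B" "span B = (UNIV :: 'a set)"
  obtains p where "p \<noteq> 0" "poly_apply T p v = 0"
proof -
  define N where "N = card B"
  define g where "g i = (T ^^ i) v" for i
  have "\<exists>u::nat \<Rightarrow> real. (\<exists>i\<le>N. u i \<noteq> 0) \<and> (\<Sum>i\<le>N. u i *\<^sub>R g i) = 0"
  \<comment> \<open>Dependence concerns the set of iterates, so coinciding iterates are treated
    apart: their difference is a relation.\<close>
  proof (cases "inj_on g {..N}")
    case True
    have "dependent (g ` {..N})"
    proof (rule ccontr)
      assume "independent (g ` {..N})"
      then have "card (g ` {..N}) \<le> card B"
        using real_vector.independent_span_bound[OF assms(1), of "g ` {..N}"] assms(2) by auto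
      then show False
        using card_image[OF True] by (simp add: N_def)
    qed
    then obtain u where u: "\<exists>w\<in>g ` {..N}. u w \<noteq> 0" "(\<Sum>w\<in>g ` {..N}. u w *\<^sub>R w) = 0"
      using dependent_finite[of "g ` {..N}"] by auto
    show ?thesis
      by (rule exI[of _ "u \<circ> g"]) (use u in \<open>auto simp: sum.reindex[OF True]\<close>)
  next
    case False
    then obtain i j where ij: "i \<le> N" "j \<le> N" "i \<noteq> j" "g i = g j"
      by (auto simp: inj_on_def)
    define u where "u l = (if l = i then 1 else if l = j then - 1 else 0 :: real)" for l
    have "(\<Sum>l\<le>N. u l *\<^sub>R g l) = (\<Sum>l\<in>{i, j}. u l *\<^sub>R g l)"
      by (rule sum.mono_neutral_right) (use ij in \<open>auto simp: u_def\<close>)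
    also have "\<dots> = 0"
      using ij by (simp add: u_def)
    finally show ?thesis
      using ij by (intro exI[of _ u]) (auto simp: u_def)
  qed
  then obtain u :: "nat \<Rightarrow> real" where
    u: "\<exists>i\<le>N. u i \<noteq> 0" "(\<Sum>i\<le>N. u i *\<^sub>R g i) = 0"
    by blast
  define p where "p = (\<Sum>i\<le>N. monom (u i) i)"
  have coeff: "coeff p i = (if i \<le> N then u i else 0)" for i
    by (simp add: p_def coeff_sum)
  have "degree p \<le> N"
    by (rule degree_le) (auto simp: coeff)
  then have "poly_apply T p v = 0"
    using u(2) by (simp add: poly_apply_altdef[of _ N] coeff g_def)
  moreover have "p \<noteq> 0"
    using u(1) coeff by (metis coeff_0)
  ultimately show ?thesis
    using that by blast
qed

text \<open>Take a real polynomial \<open>p\<close> of least degree annihilating some nonzero vector of \<open>W\<close>, and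
  write \<open>p = (X - z) q\<close> with a complex root \<open>z\<close>. The real and imaginary parts of \<open>q(T) v\<close>, not
  both zero by minimality, are vectors on which \<open>T - Re z\<close> acts as a rotation scaled by \<open>Im z\<close>;
  symmetry of \<open>T\<close> forces \<open>Im z = 0\<close>.\<close>

lemma symmetric_eigenvector:
  fixes T :: "'a::real_vector \<Rightarrow> 'a" and b :: "'a \<Rightarrow> 'a \<Rightarrow> real"
  assumes B: "finite B" "span B = (UNIV :: 'a set)"
    and T: "linear T" "\<And>v w. b (T v) w = b v (T w)"
    and b: "bilinear b" "\<And>v. v \<noteq> 0 \<Longrightarrow> b v v > 0"
    and W: "subspace W" "\<And>w. w \<in> W \<Longrightarrow> T w \<in> W" "W \<noteq> {0}"
  obtains v c where "v \<in> W" "v \<noteq> 0" "T v = c *\<^sub>R v"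
proof -
  define P where "P p \<longleftrightarrow> p \<noteq> 0 \<and> (\<exists>v\<in>W. v \<noteq> 0 \<and> poly_apply T p v = 0)" for p
  obtain v0 where v0: "v0 \<in> W" "v0 \<noteq> 0"
    using W(1,3) subspace_0 by blast
  obtain p0 where "p0 \<noteq> 0" "poly_apply T p0 v0 = 0"
    using ex_annihilating_poly[OF B] by blast
  then have "P p0"
    using v0 by (auto simp: P_def)
  then obtain p where "P p" and min: "\<And>q. P q \<Longrightarrow> degree p \<le> degree q"
    using ex_has_least_nat[of P p0 degree] by blast
  then obtain v where v: "p \<noteq> 0" "v \<in> W" "v \<noteq> 0" "poly_apply T p v = 0"
    by (auto simp: P_def)
  have deg: "degree p > 0"
  proof (rule ccontr)
    assume "\<not> degree p > 0"
    then have "degree p = 0" by simp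
    then have "coeff p 0 *\<^sub>R v = 0"
      using v(4) by (simp add: poly_apply_def)
    then show False
      using v(1,3) \<open>degree p = 0\<close> leading_coeff_neq_0[of p] by simp
  qed
  define pc where "pc = map_poly complex_of_real p"
  have coeff_pc: "coeff pc i = of_real (coeff p i)" for i
    by (simp add: pc_def coeff_map_poly)
  have deg_pc: "degree pc = degree p"
    by (simp add: pc_def degree_map_poly)
  have "\<not> constant (poly pc)"
    using deg deg_pc by (simp add: constant_degree)
  then obtain z where "poly pc z = 0"
    using fundamental_theorem_of_algebra by blast
  then obtain q where q: "pc = [:-z, 1:] * q"
    by (auto simp: poly_eq_0_iff_dvd elim: dvdE)
  have "q \<noteq> 0"
    using q deg deg_pc by auto
  have "degree pc = degree [:-z, 1:] + degree q"
    unfolding q by (rule degree_mult_eq) (use \<open>q \<noteq> 0\<close> in auto)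
  then have deg_q: "degree q < degree p"
    using deg_pc by simp
  have pc_q: "pc = pCons 0 q - smult z q"
    by (simp add: q mult_pCons_left)
  define q1 where "q1 = map_poly Re q"
  define q2 where "q2 = map_poly Im q"
  have coeff_q: "coeff q1 i = Re (coeff q i)" "coeff q2 i = Im (coeff q i)" for i
    by (simp_all add: q1_def q2_def coeff_map_poly)
  have "degree q1 < degree p" "degree q2 < degree p"
    using deg_q map_poly_degree_leq[of Re q] map_poly_degree_leq[of Im q]
    by (auto simp: q1_def q2_def)
  then have nP: "\<not> P q1" "\<not> P q2"
    using min[of q1] min[of q2] by auto
  \<comment> \<open>The real and imaginary parts of this identity are two identities between real
    polynomials; evaluated at \<open>T\<close> on \<open>v\<close> they become \<open>T1\<close> and
    \<open>T2\<close>.\<close>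
  have coeff_p: "of_real (coeff p i) = coeff (pCons 0 q) i - z * coeff q i" for i
    using coeff_pc[of i] pc_q by simp
  have re: "p = pCons 0 q1 - smult (Re z) q1 + smult (Im z) q2"
  proof (rule poly_eqI)
    fix i
    show "coeff p i = coeff (pCons 0 q1 - smult (Re z) q1 + smult (Im z) q2) i"
      using arg_cong[OF coeff_p[of i], of Re] by (cases i) (auto simp: coeff_q)
  qed
  have im: "pCons 0 q2 - smult (Re z) q2 - smult (Im z) q1 = 0"
  proof (rule poly_eqI)
    fix i
    show "coeff (pCons 0 q2 - smult (Re z) q2 - smult (Im z) q1) i = coeff 0 i"
      using arg_cong[OF coeff_p[of i], of Im] by (cases i) (auto simp: coeff_q)
  qed
  define u1 where "u1 = poly_apply T q1 v"
  define u2 where "u2 = poly_apply T q2 v"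
  have u_W: "u1 \<in> W" "u2 \<in> W"
    unfolding u1_def u2_def by (auto intro: poly_apply_mem[OF W(1,2) v(2)])
  have "u1 \<noteq> 0 \<or> u2 \<noteq> 0"
  proof (rule ccontr)
    assume "\<not> ?thesis"
    then have "q1 = 0" "q2 = 0"
      using nP v by (auto simp: P_def u1_def u2_def)
    then have "coeff q i = 0" for i
      using coeff_q[of i] by (simp add: complex_eq_iff)
    then show False
      using \<open>q \<noteq> 0\<close> by (simp add: poly_eq_iff)
  qed
  have T1: "T u1 = Re z *\<^sub>R u1 - Im z *\<^sub>R u2"
    using v(4) unfolding u1_def u2_def
    by (subst (asm) re)
       (simp add: poly_apply_add poly_apply_diff poly_apply_smult poly_apply_pCons_0 T algebra_simps)
  have T2: "T u2 = Re z *\<^sub>R u2 + Im z *\<^sub>R u1"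
    using arg_cong[OF im, of "\<lambda>p. poly_apply T p v"] unfolding u1_def u2_def
    by (simp add: poly_apply_add poly_apply_diff poly_apply_smult poly_apply_pCons_0 T algebra_simps)
  have "b (T u1) u2 = b u1 (T u2)"
    by (rule T)
  \<comment> \<open>The \<open>Re z\<close> terms agree on both sides and cancel.\<close>
  then have "Im z * (b u1 u1 + b u2 u2) = 0"
    by (simp add: T1 T2 bilinear_lsub[OF b(1)] bilinear_radd[OF b(1)] bilinear_lmul[OF b(1)]
        bilinear_rmul[OF b(1)] algebra_simps)
  moreover have "b u u \<ge> 0" for u
    using b(2)[of u] bilinear_lzero[OF b(1)] by (cases "u = 0") auto
  then have "b u1 u1 + b u2 u2 > 0"
    using \<open>u1 \<noteq> 0 \<or> u2 \<noteq> 0\<close> b(2) by (meson add_nonneg_pos add_pos_nonneg)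
  ultimately have "Im z = 0"
    by simp
  then have "T u1 = Re z *\<^sub>R u1" "T u2 = Re z *\<^sub>R u2"
    using T1 T2 by simp_all
  then show ?thesis
    using that \<open>u1 \<noteq> 0 \<or> u2 \<noteq> 0\<close> u_W by blast
qed

text \<open>A vector of \<open>W\<close> outside \<open>span D\<close> would extend \<open>D\<close>
  to an independent subset of \<open>span C\<close> with more than \<open>card C\<close>
  elements.\<close>

lemma subspace_eq_of_card_le:
  fixes U W :: "'a::real_vector set"
  assumes "subspace U" "U \<subseteq> W" "W = span C" "finite C"
    and D: "independent D" "span D = U" "card C \<le> card D"
  shows "U = W"
proof (rule ccontr)
  assume "U \<noteq> W"
  then obtain x where x: "x \<in> W" "x \<notin> span D"
    using assms by auto
  have "independent (insert x D)"
    using x(2) D(1) by (rule independent_insertI)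
  moreover have "insert x D \<subseteq> span C"
    using x(1) assms(2,3) D(2) span_superset[of D] by auto
  ultimately have "finite (insert x D)" "card (insert x D) \<le> card C"
    using real_vector.independent_span_bound[OF assms(4), of "insert x D"] by simp_all
  moreover have "x \<notin> D"
    using x(2) span_base by blast
  ultimately show False
    using D(3) by simp
qed

text \<open>In an invariant subspace of least dimension, the eigenspaces of each \<open>T\<close> are invariant
  under the whole family, so each \<open>T\<close> is scalar there.\<close>

lemma common_eigenvector:
  fixes \<T> :: "('a::real_vector \<Rightarrow> 'a) set" and b :: "'a \<Rightarrow> 'a \<Rightarrow> real"
  assumes B: "finite B" "span B = (UNIV :: 'a set)"
    and T: "\<And>T. T \<in> \<T> \<Longrightarrow> linear T" "\<And>T v w. T \<in> \<T> \<Longrightarrow> b (T v) w = b v (T w)"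
      "\<And>T U v. T \<in> \<T> \<Longrightarrow> U \<in> \<T> \<Longrightarrow> T (U v) = U (T v)"
    and b: "bilinear b" "\<And>v. v \<noteq> 0 \<Longrightarrow> b v v > 0"
    and S: "subspace S" "\<And>T w. T \<in> \<T> \<Longrightarrow> w \<in> S \<Longrightarrow> T w \<in> S" "S \<noteq> {0}"
  shows "\<exists>v\<in>S. v \<noteq> 0 \<and> (\<forall>T\<in>\<T>. \<exists>c. T v = c *\<^sub>R v)"
proof -
  \<comment> \<open>Invariant subspaces are represented by bases, so least dimension becomes least
    cardinality.\<close>
  define P where "P C \<longleftrightarrow> independent C \<and> span C \<subseteq> S \<and> span C \<noteq> {0} \<and>
    (\<forall>T\<in>\<T>. \<forall>w\<in>span C. T w \<in> span C)" for C
  have basis: "\<exists>C. independent C \<and> span C = W" if "subspace W" for W :: "'a set"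
  proof -
    obtain C where "C \<subseteq> W" "independent C" "W \<subseteq> span C"
      using maximal_independent_subset by blast
    then show ?thesis
      using that by (metis span_subspace)
  qed
  obtain C0 where "independent C0" "span C0 = S"
    using basis[OF S(1)] by blast
  then have "P C0"
    using S by (auto simp: P_def)
  then obtain C where "P C" and min: "\<And>D. P D \<Longrightarrow> card C \<le> card D"
    using ex_has_least_nat[of P C0 card] by blast
  define W where "W = span C"
  have C: "independent C" "W \<subseteq> S" "W \<noteq> {0}" "\<And>T w. T \<in> \<T> \<Longrightarrow> w \<in> W \<Longrightarrow> T w \<in> W"
    using \<open>P C\<close> by (auto simp: P_def W_def)
  have W: "subspace W"
    by (simp add: W_def)
  have "finite C"
    using real_vector.independent_span_bound[of B C] B C(1) by auto
  have eig: "\<exists>c. \<forall>v\<in>W. T v = c *\<^sub>R v" if "T \<in> \<T>" for T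
  proof -
    obtain v c where v: "v \<in> W" "v \<noteq> 0" "T v = c *\<^sub>R v"
      using symmetric_eigenvector[OF B T(1,2)[OF \<open>T \<in> \<T>\<close>] b W C(4)[OF \<open>T \<in> \<T>\<close>] C(3)] by blast
    define U where "U = {w \<in> W. T w = c *\<^sub>R w}"
    have U: "subspace U"
      using W T(1)[OF that]
      by (auto simp: U_def subspace_def linear_add linear_scale linear_0 algebra_simps)
    obtain D where D: "independent D" "span D = U"
      using basis[OF U] by blast
    have "T' w \<in> U" if "T' \<in> \<T>" "w \<in> U" for T' w
      using that \<open>T \<in> \<T>\<close> C(4) T(3)[of T T'] T(1) by (auto simp: U_def linear_scale)
    then have "P D"
      using D v C(2) by (auto simp: P_def U_def)
    then have "U = W"
      using subspace_eq_of_card_le[OF U _ W_def \<open>finite C\<close> D] min by (auto simp: U_def)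
    then show ?thesis
      by (auto simp: U_def)
  qed
  obtain v where "v \<in> W" "v \<noteq> 0"
    using C(3) W subspace_0 by blast
  then show ?thesis
    using C(2) eig by blast
qed


section \<open>Symplectic forms, frames and complements\<close>

locale symplectic_space =
  fixes n :: nat and \<omega> :: "'a::real_vector \<Rightarrow> 'a \<Rightarrow> real"
  assumes symplectic: "symplectic_vector_space n \<omega>"
begin

lemma bilinear_form: "bilinear \<omega>"
  and form_self [simp]: "\<omega> v v = 0"
  using symplectic by (auto simp: symplectic_vector_space_def)

lemmas form_simps =
  bilinear_ladd[OF bilinear_form] bilinear_radd[OF bilinear_form]
  bilinear_lsub[OF bilinear_form] bilinear_rsub[OF bilinear_form]
  bilinear_lmul[OF bilinear_form] bilinear_rmul[OF bilinear_form]
  bilinear_lneg[OF bilinear_form] bilinear_rneg[OF bilinear_form]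
  bilinear_lzero[OF bilinear_form] bilinear_rzero[OF bilinear_form]

lemma form_antisym: "\<omega> v w = - \<omega> w v"
  using form_self[of "v + w"] by (simp add: form_simps del: form_self) simp

lemma form_eqI:
  assumes "\<And>w. \<omega> u w = \<omega> v w"
  shows "u = v"
proof -
  have "\<omega> (u - v) w = 0" for w
    using assms[of w] by (simp add: form_simps)
  then show ?thesis
    using symplectic unfolding symplectic_vector_space_def by (metis eq_iff_diff_eq_0)
qed

text \<open>Packing the values of \<open>\<omega> u\<close> on a basis into a vector gives an
  endomorphism \<open>L\<close>. Nondegeneracy makes it injective, hence surjective in finite
  dimension, so every functional is reached.\<close>

lemma form_represents:
  assumes "linear \<phi>"
  shows "\<exists>u. \<forall>w. \<omega> u w = \<phi> w"
proof -
  obtain B :: "'a set" where B: "finite B" "independent B" "span B = UNIV"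
    using symplectic by (auto simp: symplectic_vector_space_def)
  interpret fin: finite_dimensional_vector_space "scaleR :: real \<Rightarrow> 'a \<Rightarrow> 'a" B
    by unfold_locales (use B in \<open>auto simp: dependent_raw_def span_raw_def algebra_simps\<close>)
  define L where "L u = (\<Sum>c\<in>B. \<omega> u c *\<^sub>R c)" for u
  have lin: "linear L"
    by (rule linearI) (simp_all add: L_def form_simps algebra_simps sum.distrib scaleR_sum_right)
  have coord: "u c = v c" if "(\<Sum>c\<in>B. u c *\<^sub>R c) = (\<Sum>c\<in>B. v c *\<^sub>R c)" "c \<in> B" for u v c
  proof -
    have "(\<Sum>c\<in>B. (u c - v c) *\<^sub>R c) = 0"
      using that(1) by (simp add: algebra_simps sum_subtractf)
    then show ?thesis
      using real_vector.independentD[OF B(2) B(1) order_refl, of "\<lambda>c. u c - v c"] that(2) by auto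
  qed
  have ext: "f = g" if "linear f" "linear g" "\<And>c. c \<in> B \<Longrightarrow> f c = g c" for f g :: "'a \<Rightarrow> real"
    using real_vector.linear_eq_on_span[of f g B] that B(3) by auto
  have "inj L"
  proof (rule injI)
    fix u v assume "L u = L v"
    then have "\<omega> u c = \<omega> v c" if "c \<in> B" for c
      using coord[of "\<omega> u" "\<omega> v"] that by (auto simp: L_def)
    then have "\<omega> u = \<omega> v"
      using bilinear_form by (intro ext) (auto simp: bilinear_def)
    then show "u = v"
      by (intro form_eqI) simp
  qed
  then have "surj L"
    using fin.linear_inj_imp_surj lin by (simp add: linear_def)
  then obtain u where "L u = (\<Sum>c\<in>B. \<phi> c *\<^sub>R c)"
    by (metis surjD)
  then have "\<omega> u c = \<phi> c" if "c \<in> B" for c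
    using coord[of "\<omega> u" \<phi>] that by (auto simp: L_def)
  then have "\<omega> u = \<phi>"
    using bilinear_form assms by (intro ext) (auto simp: bilinear_def)
  then show ?thesis
    by auto
qed

text \<open>A partial symplectic basis, to be grown one pair at a time.\<close>

definition frame :: "nat \<Rightarrow> (nat \<Rightarrow> 'a) \<Rightarrow> (nat \<Rightarrow> 'a) \<Rightarrow> bool" where
  "frame k x y \<longleftrightarrow> (\<forall>j\<in>{1..k}. \<forall>l\<in>{1..k}.
     \<omega> (x j) (y l) = (if j = l then 1 else 0) \<and> \<omega> (x j) (x l) = 0 \<and> \<omega> (y j) (y l) = 0)"

text \<open>Among the frame vectors only the partner pairs nontrivially, so pairing extracts
  coefficients; antisymmetry accounts for the minus sign.\<close>

lemma frame_coordinates: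
  assumes "frame k x y" "l \<in> {1..k}"
  shows "\<omega> (x l) (\<Sum>j=1..k. s j *\<^sub>R x j + t j *\<^sub>R y j) = t l"
    and "\<omega> (y l) (\<Sum>j=1..k. s j *\<^sub>R x j + t j *\<^sub>R y j) = - s l"
proof -
  have sum: "\<omega> w (\<Sum>j=1..k. s j *\<^sub>R x j + t j *\<^sub>R y j) = (\<Sum>j=1..k. s j * \<omega> w (x j) + t j * \<omega> w (y j))"
    for w
  proof -
    have "linear (\<omega> w)"
      using bilinear_form by (simp add: bilinear_def)
    then show ?thesis
      by (simp add: linear_sum form_simps)
  qed
  have "(\<Sum>j=1..k. s j * \<omega> (x l) (x j) + t j * \<omega> (x l) (y j)) = (\<Sum>j=1..k. if j = l then t j else 0)"
    by (rule sum.cong) (use assms in \<open>auto simp: frame_def\<close>)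
  then show "\<omega> (x l) (\<Sum>j=1..k. s j *\<^sub>R x j + t j *\<^sub>R y j) = t l"
    using assms(2) unfolding sum by simp
  have "(\<Sum>j=1..k. s j * \<omega> (y l) (x j) + t j * \<omega> (y l) (y j)) = (\<Sum>j=1..k. if j = l then - s j else 0)"
    by (rule sum.cong) (use assms form_antisym[of "y l"] in \<open>auto simp: frame_def\<close>)
  then show "\<omega> (y l) (\<Sum>j=1..k. s j *\<^sub>R x j + t j *\<^sub>R y j) = - s l"
    using assms(2) unfolding sum by simp
qed

lemma frame_independent:
  assumes "frame k x y"
  shows "independent (x ` {1..k} \<union> y ` {1..k})" "card (x ` {1..k} \<union> y ` {1..k}) = 2 * k"
proof -
  have inj: "inj_on x {1..k}" "inj_on y {1..k}"
    \<comment> \<open>Equal vectors would have equal pairings, whereas a frame vector pairs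
      nontrivially only with its partner.\<close>
    using assms unfolding inj_on_def frame_def by (metis zero_neq_one)+
  have disj: "x ` {1..k} \<inter> y ` {1..k} = {}"
  proof -
    have "x j \<noteq> y l" if "j \<in> {1..k}" "l \<in> {1..k}" for j l
      using assms that unfolding frame_def by (metis zero_neq_one)
    then show ?thesis by blast
  qed
  show "card (x ` {1..k} \<union> y ` {1..k}) = 2 * k"
    using disj card_image[OF inj(1)] card_image[OF inj(2)] by (subst card_Un_disjoint) auto
  show "independent (x ` {1..k} \<union> y ` {1..k})"
  proof (rule ccontr)
    assume "\<not> independent (x ` {1..k} \<union> y ` {1..k})"
    then obtain u where u: "\<exists>v\<in>x ` {1..k} \<union> y ` {1..k}. u v \<noteq> 0"
      "(\<Sum>v\<in>x ` {1..k} \<union> y ` {1..k}. u v *\<^sub>R v) = 0"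
      using real_vector.dependent_finite[of "x ` {1..k} \<union> y ` {1..k}"] by auto
    have "(\<Sum>j=1..k. u (x j) *\<^sub>R x j + u (y j) *\<^sub>R y j) = 0"
      using u(2) disj by (simp add: sum.union_disjoint sum.reindex[OF inj(1)] sum.reindex[OF inj(2)] sum.distrib del: One_nat_def)
    then have "u (x l) = 0 \<and> u (y l) = 0" if "l \<in> {1..k}" for l
      using frame_coordinates[OF assms that, of "\<lambda>j. u (x j)" "\<lambda>j. u (y j)"]
      by (simp add: form_simps)
    then show False
      using u(1) by blast
  qed
qed

lemma frame_le: "frame k x y \<Longrightarrow> k \<le> n"
proof -
  assume fr: "frame k x y"
  obtain B :: "'a set" where B: "finite B" "span B = UNIV" "card B = 2 * n"
    using symplectic by (auto simp: symplectic_vector_space_def)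
  show "k \<le> n"
    using real_vector.independent_span_bound[OF B(1) frame_independent(1)[OF fr]] B
      frame_independent(2)[OF fr] by auto
qed

text \<open>The symplectic complement of the span of the frame; for \<open>k = 0\<close> it is the
  whole space.\<close>

definition frame_complement :: "nat \<Rightarrow> (nat \<Rightarrow> 'a) \<Rightarrow> (nat \<Rightarrow> 'a) \<Rightarrow> 'a set" where
  "frame_complement k x y = {v. \<forall>j\<in>{1..k}. \<omega> v (x j) = 0 \<and> \<omega> v (y j) = 0}"

lemma subspace_frame_complement: "subspace (frame_complement k x y)"
  by (auto simp: subspace_def frame_complement_def form_simps)

text \<open>Removing from a vector its symplectic projection leaves a vector of the complement, so a
  trivial complement forces spanning; comparing cardinalities then gives
  \<open>k = n\<close>.\<close>

lemma symplectic_basis_of_frame: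
  assumes fr: "frame k x y" and "frame_complement k x y = {0}"
  shows "k = n" "symplectic_basis n \<omega> x y"
proof -
  define E where "E = x ` {1..k} \<union> y ` {1..k}"
  have E: "independent E" "card E = 2 * k" "finite E"
    using frame_independent[OF fr] by (simp_all add: E_def)
  have span: "span E = UNIV"
  proof -
    have "v \<in> span E" for v
    proof -
      \<comment> \<open>The coefficients are dictated by \<open>frame_coordinates\<close>:
        \<open>p\<close> must pair with every frame vector as \<open>v\<close> does.\<close>
      define p where "p = (\<Sum>j=1..k. \<omega> v (y j) *\<^sub>R x j + (- \<omega> v (x j)) *\<^sub>R y j)"
      have "\<omega> p (x l) = \<omega> v (x l) \<and> \<omega> p (y l) = \<omega> v (y l)" if "l \<in> {1..k}" for l
        using frame_coordinates[OF fr that, of "\<lambda>j. \<omega> v (y j)" "\<lambda>j. - \<omega> v (x j)", folded p_def]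
        by (simp add: form_antisym[of p "x l"] form_antisym[of p "y l"])
      then have "v - p \<in> frame_complement k x y"
        by (simp add: frame_complement_def form_simps)
      then have "v = p"
        using assms(2) by simp
      also have "p \<in> span E"
        unfolding p_def E_def by (intro span_sum span_add span_scale span_base) auto
      finally show ?thesis .
    qed
    then show ?thesis by auto
  qed
  obtain B :: "'a set" where B: "finite B" "independent B" "card B = 2 * n"
    using symplectic by (auto simp: symplectic_vector_space_def)
  have "card B \<le> card E"
    using real_vector.independent_span_bound[OF E(3) B(2)] span by simp
  then show "k = n"
    using B(3) E(2) frame_le[OF fr] by simp
  then show "symplectic_basis n \<omega> x y"
    using E span fr unfolding symplectic_basis_def frame_def E_def by simp
qed

end

section \<open>Commuting Hamiltonian operators and diagonal frames\<close>

locale commuting_forms = symplectic_space n \<omega>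
  for n :: nat and \<omega> :: "'a::real_vector \<Rightarrow> 'a \<Rightarrow> real" +
  fixes F :: "'i set" and b :: "'i \<Rightarrow> 'a \<Rightarrow> 'a \<Rightarrow> real" and A :: "'i \<Rightarrow> 'a \<Rightarrow> 'a"
  assumes nonempty: "F \<noteq> {}"
    and bil: "f \<in> F \<Longrightarrow> bilinear (b f)"
    and sym: "f \<in> F \<Longrightarrow> b f v w = b f w v"
    and pos: "f \<in> F \<Longrightarrow> v \<noteq> 0 \<Longrightarrow> b f v v > 0"
    and form_A: "f \<in> F \<Longrightarrow> \<omega> (A f v) w = b f v w"
    and comm: "f \<in> F \<Longrightarrow> g \<in> F \<Longrightarrow> A f (A g v) = A g (A f v)"
begin

lemma A_right: "f \<in> F \<Longrightarrow> \<omega> v (A f w) = - b f v w"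
  using form_antisym[of v] form_A sym by simp

text \<open>Symmetry of \<open>b f\<close> puts \<open>A f\<close> in the symplectic Lie
  algebra.\<close>

lemma A_skew: "f \<in> F \<Longrightarrow> \<omega> (A f v) w = - \<omega> v (A f w)"
  using form_A A_right by simp

lemma linear_A: "f \<in> F \<Longrightarrow> linear (A f)"
  by (rule linearI; rule form_eqI)
     (simp_all add: form_simps form_A bilinear_ladd[OF bil] bilinear_lmul[OF bil])

text \<open>On each plane of the frame \<open>A f\<close> is a quarter turn scaled by
  \<open>c\<close>, the Williamson coefficient of \<open>f\<close> there.\<close>

definition diagonal_frame :: "nat \<Rightarrow> (nat \<Rightarrow> 'a) \<Rightarrow> (nat \<Rightarrow> 'a) \<Rightarrow> bool" where
  "diagonal_frame k x y \<longleftrightarrow> frame k x y \<and>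
     (\<forall>f\<in>F. \<forall>j\<in>{1..k}. \<exists>c>0. A f (x j) = (- c) *\<^sub>R y j \<and> A f (y j) = c *\<^sub>R x j)"

text \<open>Skewness moves \<open>A f\<close> onto the frame vector, which it sends to a multiple of
  its partner.\<close>

lemma A_frame_complement:
  assumes "diagonal_frame k x y" "f \<in> F" "v \<in> frame_complement k x y"
  shows "A f v \<in> frame_complement k x y"
proof -
  have "\<omega> (A f v) (x j) = 0 \<and> \<omega> (A f v) (y j) = 0" if "j \<in> {1..k}" for j
  proof -
    obtain c where "A f (x j) = (- c) *\<^sub>R y j" "A f (y j) = c *\<^sub>R x j"
      using assms(1,2) \<open>j \<in> {1..k}\<close> unfolding diagonal_frame_def by blast
    then show ?thesis
      using assms(3) that by (simp add: A_skew[OF assms(2)] form_simps frame_complement_def)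
  qed
  then show ?thesis
    by (simp add: frame_complement_def)
qed

text \<open>From \<open>A h (A f v) = e f v\<close> for all \<open>f\<close> and injectivity of \<open>A h\<close> one gets
  \<open>A f v = (e f / e h) A h v\<close>; the scalars \<open>r\<close> and \<open>m\<close> below normalise the basis of this
  plane.\<close>

lemma diagonal_plane:
  assumes S: "subspace S" "\<And>f w. f \<in> F \<Longrightarrow> w \<in> S \<Longrightarrow> A f w \<in> S" "S \<noteq> {0}"
  obtains x y where "x \<in> S" "y \<in> S" "\<omega> x y = 1"
    "\<And>f. f \<in> F \<Longrightarrow> \<exists>c>0. A f x = (- c) *\<^sub>R y \<and> A f y = c *\<^sub>R x"
proof -
  obtain h where h: "h \<in> F"
    using nonempty by blast
  obtain B :: "'a set" where B: "finite B" "span B = UNIV"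
    using symplectic by (auto simp: symplectic_vector_space_def)
  \<comment> \<open>\<open>A f\<close> alone has no real eigenvector, since
    \<open>\<omega> (A f v) v = b f v v\<close> is positive for nonzero \<open>v\<close>. It is skew
    for \<open>b h\<close>, so products of two such commuting operators are symmetric.\<close>
  define \<T> where "\<T> = (\<lambda>f. A h \<circ> A f) ` F"
  have lin: "linear T" if "T \<in> \<T>" for T
    using that h by (auto simp: \<T>_def intro: linear_compose linear_A)
  have symm: "b h (T v) w = b h v (T w)" if "T \<in> \<T>" for T v w
  proof -
    obtain f where f: "f \<in> F" "T = A h \<circ> A f"
      using \<open>T \<in> \<T>\<close> unfolding \<T>_def by blast
    have "b h (T v) w = \<omega> (A h (A h (A f v))) w"
      by (simp add: form_A h f)
    also have "A h (A h (A f v)) = A f (A h (A h v))"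
      using comm h f by simp
    also have "\<omega> (A f (A h (A h v))) w = \<omega> (A h v) (A h (A f w))"
      using A_skew h f comm by simp
    also have "\<dots> = b h v (T w)"
      by (simp add: form_A h f)
    finally show ?thesis .
  qed
  have commute: "T (U v) = U (T v)" if "T \<in> \<T>" "U \<in> \<T>" for T U v
    using that h by (auto simp: \<T>_def comm)
  have inv: "T w \<in> S" if "T \<in> \<T>" "w \<in> S" for T w
    using that S(2) h by (auto simp: \<T>_def)
  have "\<exists>v\<in>S. v \<noteq> 0 \<and> (\<forall>T\<in>\<T>. \<exists>c. T v = c *\<^sub>R v)"
    by (rule common_eigenvector[where \<T> = \<T> and b = "b h" and S = S, OF B])
      (fact lin symm commute bil[OF h] pos[OF h] S(1) inv S(3))+
  then obtain v where v: "v \<in> S" "v \<noteq> 0" and "\<forall>f\<in>F. \<exists>c. A h (A f v) = c *\<^sub>R v"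
    by (auto simp: \<T>_def)
  then obtain e where e: "\<And>f. f \<in> F \<Longrightarrow> A h (A f v) = e f *\<^sub>R v"
    by metis
  have inj: "A h u \<noteq> 0" if "u \<noteq> 0" for u
    using pos[OF h that] form_A[OF h, of u u] by (auto simp: form_simps)
  \<comment> \<open>The square of the operator \<open>A h\<close>, skew for \<open>b h\<close>, has
    a negative eigenvalue.\<close>
  have "e h * b h v v = - b h (A h v) (A h v)"
    using form_A[OF h, of "A h v" "A h v"] A_skew[OF h, of "A h (A h v)" v]
    by (simp add: e h form_simps form_A A_right bilinear_lmul[OF bil[OF h]])
  also have "\<dots> < 0"
    using pos[OF h inj[OF v(2)]] by simp
  finally have "e h < 0"
    using pos[OF h v(2)] by (simp add: mult_less_0_iff)
  \<comment> \<open>\<open>A h\<close> squares to \<open>- (m * m)\<close> on the plane, so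
    \<open>m\<close> is the coefficient that \<open>h\<close> receives there.\<close>
  define m where "m = sqrt (- e h)"
  have m: "m > 0" "m * m = - e h"
    using \<open>e h < 0\<close> by (simp_all add: m_def)
  \<comment> \<open>With \<open>y\<close> as below, \<open>\<omega> x y\<close> equals
    \<open>r * r * b h v v / m\<close>; this choice makes it 1.\<close>
  define r where "r = sqrt (m / b h v v)"
  have r: "r > 0" "r * r * b h v v = m"
    using m(1) pos[OF h v(2)] by (simp_all add: r_def)
  define x where "x = r *\<^sub>R v"
  define y where "y = (- inverse m) *\<^sub>R A h x"
  have ex: "A h (A f x) = e f *\<^sub>R x" if "f \<in> F" for f
    using e[OF that] linear_A[OF that] linear_A[OF h] by (simp add: x_def linear_scale)
  have "x \<noteq> 0"
    using r v by (simp add: x_def)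
  have xS: "x \<in> S"
    unfolding x_def by (rule subspace_scale[OF S(1) v(1)])
  have yS: "y \<in> S"
    unfolding y_def by (rule subspace_scale[OF S(1) S(2)[OF h xS]])
  have xy: "\<omega> x y = 1"
    using r m by (simp add: y_def form_simps A_right[OF h] x_def bilinear_lmul[OF bil[OF h]]
        bilinear_rmul[OF bil[OF h]] field_simps)
  have "\<exists>c>0. A f x = (- c) *\<^sub>R y \<and> A f y = c *\<^sub>R x" if f: "f \<in> F" for f
  proof -
    define c where "c = - e f / m"
    have "A h (A f x - (e f / e h) *\<^sub>R A h x) = 0"
      using ex[OF f] ex[OF h] \<open>e h < 0\<close> linear_A[OF h] by (simp add: linear_diff linear_scale)
    then have "A f x = (e f / e h) *\<^sub>R A h x"
      using inj by force
    also have "\<dots> = (- c) *\<^sub>R y"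
      using m \<open>e h < 0\<close> by (simp add: c_def y_def field_simps)
    finally have Ax: "A f x = (- c) *\<^sub>R y" .
    have Ay: "A f y = c *\<^sub>R x"
      using ex[OF f] linear_A[OF f] comm[OF f h, of x]
      by (simp add: y_def linear_scale linear_neg c_def field_simps)
    \<comment> \<open>Reading the coefficient as the value of the form at \<open>x\<close> yields
      its sign.\<close>
    have "c = b f x x"
      using form_A[OF f, of x x] xy form_antisym[of y x] by (simp add: Ax form_simps)
    then have "c > 0"
      using pos[OF f \<open>x \<noteq> 0\<close>] by simp
    then show ?thesis
      using Ax Ay by blast
  qed
  then show ?thesis
    using that xS yS xy by blast
qed

text \<open>The complement is invariant and nonzero, so it contains a diagonal plane, and its
  vectors pair to zero with the old frame.\<close>

lemma diagonal_frame_extend: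
  assumes fr: "diagonal_frame k x y" and "frame_complement k x y \<noteq> {0}"
  obtains x' y' where "diagonal_frame (Suc k) x' y'"
proof -
  obtain p q where pq: "p \<in> frame_complement k x y" "q \<in> frame_complement k x y" "\<omega> p q = 1"
    and A: "\<And>f. f \<in> F \<Longrightarrow> \<exists>c>0. A f p = (- c) *\<^sub>R q \<and> A f q = c *\<^sub>R p"
    using diagonal_plane[OF subspace_frame_complement A_frame_complement[OF fr] assms(2)] by blast
  define x' where "x' = x(Suc k := p)"
  define y' where "y' = y(Suc k := q)"
  have zero: "\<omega> p (x j) = 0" "\<omega> p (y j) = 0" "\<omega> q (x j) = 0" "\<omega> q (y j) = 0"
      "\<omega> (x j) p = 0" "\<omega> (y j) p = 0" "\<omega> (x j) q = 0" "\<omega> (y j) q = 0" if "j \<in> {1..k}" for j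
    using pq that form_antisym[of "x j"] form_antisym[of "y j"]
    by (auto simp: frame_complement_def)
  have range: "{1..Suc k} = insert (Suc k) {1..k}"
    by auto
  have "frame (Suc k) x' y'"
    using fr zero pq(3) unfolding frame_def diagonal_frame_def range
    by (auto simp: x'_def y'_def)
  moreover have "\<forall>f\<in>F. \<forall>j\<in>{1..Suc k}. \<exists>c>0. A f (x' j) = (- c) *\<^sub>R y' j \<and> A f (y' j) = c *\<^sub>R x' j"
    using fr A unfolding diagonal_frame_def range by (auto simp: x'_def y'_def)
  ultimately show ?thesis
    using that by (auto simp: diagonal_frame_def)
qed

text \<open>The empty frame is diagonal and \<open>frame_le\<close> bounds the length, so a longest
  diagonal frame exists; since it cannot be extended, its complement is trivial.\<close>

lemma ex_diagonal_basis:
  obtains x y where "symplectic_basis n \<omega> x y" "diagonal_frame n x y"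
proof -
  have "diagonal_frame 0 undefined undefined"
    by (simp add: diagonal_frame_def frame_def)
  moreover have "k \<le> n" if "\<exists>x y. diagonal_frame k x y" for k
    using that frame_le by (auto simp: diagonal_frame_def)
  ultimately obtain k x y where k: "diagonal_frame k x y"
    and max: "\<And>l. \<exists>x y. diagonal_frame l x y \<Longrightarrow> l \<le> k"
    using GreatestI_nat[of "\<lambda>k. \<exists>x y. diagonal_frame k x y" 0 n]
      Greatest_le_nat[of "\<lambda>k. \<exists>x y. diagonal_frame k x y" _ n] by blast
  have "frame_complement k x y = {0}"
  proof (rule ccontr)
    assume "frame_complement k x y \<noteq> {0}"
    then obtain x' y' where "diagonal_frame (Suc k) x' y'"
      using diagonal_frame_extend[OF k] by blast
    then show False
      using max[of "Suc k"] by auto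
  qed
  then show ?thesis
    using that symplectic_basis_of_frame[of k x y] k by (auto simp: diagonal_frame_def)
qed

lemma diagonal_frame_form:
  assumes fr: "diagonal_frame k x y" and f: "f \<in> F"
  shows "\<exists>\<mu>. (\<forall>j\<in>{1..k}. \<mu> j > 0) \<and> (\<forall>s t. let v = \<Sum>j=1..k. s j *\<^sub>R x j + t j *\<^sub>R y j in
    b f v v = (\<Sum>j=1..k. \<mu> j * ((s j)\<^sup>2 + (t j)\<^sup>2)))"
proof -
  have "\<forall>j\<in>{1..k}. \<exists>c>0. A f (x j) = (- c) *\<^sub>R y j \<and> A f (y j) = c *\<^sub>R x j"
    using fr f by (auto simp: diagonal_frame_def)
  then obtain \<mu> where \<mu>: "\<And>j. j \<in> {1..k} \<Longrightarrow>
      \<mu> j > 0 \<and> A f (x j) = (- \<mu> j) *\<^sub>R y j \<and> A f (y j) = \<mu> j *\<^sub>R x j"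
    by metis
  have "b f v v = (\<Sum>j=1..k. \<mu> j * ((s j)\<^sup>2 + (t j)\<^sup>2))"
    if v: "v = (\<Sum>j=1..k. s j *\<^sub>R x j + t j *\<^sub>R y j)" for s t v
  proof -
    have fr': "frame k x y"
      using fr by (simp add: diagonal_frame_def)
    have lin: "linear (\<lambda>u. b f u v)"
      using bil[OF f] by (simp add: bilinear_def)
    have "b f (\<Sum>j=1..k. s j *\<^sub>R x j + t j *\<^sub>R y j) v
        = (\<Sum>j=1..k. s j * b f (x j) v + t j * b f (y j) v)"
      by (simp add: linear_sum[OF lin] bilinear_ladd[OF bil[OF f]] bilinear_lmul[OF bil[OF f]])
    also have "\<dots> = (\<Sum>j=1..k. \<mu> j * ((s j)\<^sup>2 + (t j)\<^sup>2))"
    proof (rule sum.cong)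
      fix j assume j: "j \<in> {1..k}"
      \<comment> \<open>Here \<open>b f (x j) v\<close> is the pairing of \<open>A f (x j)\<close>,
        a multiple of \<open>y j\<close>, with \<open>v\<close>, which is a coordinate of
        \<open>v\<close>; likewise for \<open>y j\<close>.\<close>
      have "b f (x j) v = \<mu> j * s j" "b f (y j) v = \<mu> j * t j"
        using \<mu>[OF j] frame_coordinates[OF fr' j, of s t]
        by (simp_all add: form_A[OF f, symmetric] form_simps v)
      then show "s j * b f (x j) v + t j * b f (y j) v = \<mu> j * ((s j)\<^sup>2 + (t j)\<^sup>2)"
        by (simp add: power2_eq_square algebra_simps)
    qed simp
    finally show ?thesis
      unfolding v[symmetric] .
  qed
  then show ?thesis
    using \<mu> by (intro exI[of _ \<mu>]) (auto simp: Let_def)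
qed

end

section \<open>From Poisson brackets to commuting operators\<close>

text \<open>Along a line the form is a quadratic polynomial in \<open>t\<close>, whose linear
  coefficient is the derivative at 0.\<close>

lemma differential_bilinear:
  assumes "bilinear b" "\<And>v w. b v w = b w v" "\<And>v. f v = b v v"
  shows "differential f v w = 2 * b v w"
proof -
  have eq: "f (v + t *\<^sub>R w) = b v v + 2 * t * b v w + t\<^sup>2 * b w w" for t
    using assms(2)[of w v]
    by (simp add: assms(3) bilinear_ladd[OF assms(1)] bilinear_radd[OF assms(1)]
        bilinear_lmul[OF assms(1)] bilinear_rmul[OF assms(1)] power2_eq_square algebra_simps)
  show ?thesis
    unfolding differential_def eq
    by (rule DERIV_imp_deriv) (auto intro!: derivative_eq_intros)
qed

text \<open>Nondegeneracy gives the uniqueness that the definite description asks for.\<close>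

lemma (in symplectic_space) hamiltonian_vector_field_eqI:
  assumes "\<And>w. \<omega> u w = differential f v w"
  shows "hamiltonian_vector_field \<omega> f v = u"
  unfolding hamiltonian_vector_field_def
  by (rule the_equality) (use assms in \<open>auto intro: form_eqI\<close>)

text \<open>The sum of squares of the coordinates in a basis is such a form.\<close>

lemma ex_positive_definite_form:
  assumes "symplectic_vector_space n (\<omega> :: 'a::real_vector \<Rightarrow> 'a \<Rightarrow> real)"
  shows "\<exists>f :: 'a \<Rightarrow> real. quadratic_form f \<and> positive_definite f"
proof -
  obtain B :: "'a set" where B: "finite B" "independent B" "span B = UNIV"
    using assms by (auto simp: symplectic_vector_space_def)
  define r where "r = representation B"
  define b where "b v w = (\<Sum>c\<in>B. r v c * r w c)" for v w
  have r_lin: "r (v + w) c = r v c + r w c" "r (a *\<^sub>R v) c = a * r v c" for v w a c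
    using B by (simp_all add: r_def representation_add representation_scale)
  have "bilinear b"
    by (auto simp: bilinear_def b_def r_lin algebra_simps sum.distrib sum_distrib_left intro!: linearI)
  moreover have "b v w = b w v" for v w
    by (simp add: b_def mult.commute)
  moreover have "b v v > 0" if "v \<noteq> 0" for v
  proof -
    have "(\<Sum>c\<in>B. r v c *\<^sub>R c) = v"
      unfolding r_def by (rule sum_representation_eq) (use B in auto)
    moreover have "(\<Sum>c\<in>B. r v c *\<^sub>R c) = 0" if "\<And>c. c \<in> B \<Longrightarrow> r v c = 0"
      by (rule sum.neutral) (simp add: that)
    ultimately obtain c where "c \<in> B" "r v c \<noteq> 0"
      using \<open>v \<noteq> 0\<close> by fastforce
    then show ?thesis
      unfolding b_def by (intro sum_pos2[OF B(1)]) (auto simp: zero_less_mult_iff linorder_neq_iff)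
  qed
  ultimately show ?thesis
    unfolding quadratic_form_def positive_definite_def by (intro exI[of _ "\<lambda>v. b v v"]) auto
qed

lemma simultaneous_williamson:
  fixes \<omega> :: "'a::real_vector \<Rightarrow> 'a \<Rightarrow> real"
  assumes symp: "symplectic_vector_space n \<omega>"
    and forms: "\<And>f. f \<in> F \<Longrightarrow> quadratic_form f \<and> positive_definite f"
    and poisson: "\<And>f g v. f \<in> F \<Longrightarrow> g \<in> F \<Longrightarrow> poisson_bracket \<omega> f g v = 0"
    and "F \<noteq> {}"
  shows "\<exists>x y :: nat \<Rightarrow> 'a. symplectic_basis n \<omega> x y \<and>
           (\<forall>f\<in>F. \<exists>\<mu> :: nat \<Rightarrow> real. (\<forall>j\<in>{1..n}. \<mu> j > 0) \<and>
              (\<forall>s t :: nat \<Rightarrow> real.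
                 f (\<Sum>j=1..n. s j *\<^sub>R x j + t j *\<^sub>R y j)
                   = (\<Sum>j=1..n. \<mu> j * ((s j)\<^sup>2 + (t j)\<^sup>2))))"
proof -
  interpret symplectic_space n \<omega>
    by unfold_locales (rule symp)
  have "\<forall>f\<in>F. \<exists>b. bilinear b \<and> (\<forall>v w. b v w = b w v) \<and> (\<forall>v. f v = b v v)"
    using forms by (simp add: quadratic_form_def)
  then obtain b where b: "\<And>f. f \<in> F \<Longrightarrow> bilinear (b f)" "\<And>f v w. f \<in> F \<Longrightarrow> b f v w = b f w v"
    "\<And>f v. f \<in> F \<Longrightarrow> f v = b f v v"
    by metis
  have "\<exists>u. \<forall>w. \<omega> u w = b f v w" if "f \<in> F" for f v
    using form_represents[of "b f v"] b(1)[OF that] by (simp add: bilinear_def)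
  then obtain A where A: "\<And>f v w. f \<in> F \<Longrightarrow> \<omega> (A f v) w = b f v w"
    by metis
  have field: "hamiltonian_vector_field \<omega> f v = 2 *\<^sub>R A f v" if "f \<in> F" for f v
  proof (rule hamiltonian_vector_field_eqI)
    show "\<omega> (2 *\<^sub>R A f v) w = differential f v w" for w
      using differential_bilinear[OF b(1)[OF that] b(2)[OF that] b(3)[OF that]]
      by (simp add: form_simps A[OF that])
  qed
  have A_add: "A f (v + w) = A f v + A f w" if "f \<in> F" for f v w
    by (rule form_eqI) (simp add: form_simps A[OF that] bilinear_ladd[OF b(1)[OF that]])
  have A_right: "\<omega> v (A f w) = - \<omega> (A f v) w" if "f \<in> F" for f v w
    using form_antisym[of v] A[OF that] b(2)[OF that] by simp
  have comm: "A f (A g v) = A g (A f v)" if fg: "f \<in> F" "g \<in> F" for f g v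
  proof (rule form_eqI)
    fix w
    have zero: "\<omega> (A f u) (A g u) = 0" for u
      using poisson[OF fg, of u] by (simp add: poisson_bracket_def field fg form_simps)
    \<comment> \<open>Polarisation turns the vanishing of the bracket at every point into a bilinear
      identity; skewness then rewrites it as commutation.\<close>
    have "\<omega> (A f v) (A g w) + \<omega> (A f w) (A g v) = 0"
      using zero[of "v + w"] zero[of v] zero[of w] by (simp add: A_add fg form_simps)
    then show "\<omega> (A f (A g v)) w = \<omega> (A g (A f v)) w"
      using A_right[OF fg(2), of "A f v" w] A_right[OF fg(1), of "A g v" w]
        form_antisym[of "A f w" "A g v"] by simp
  qed
  interpret commuting_forms n \<omega> F b A
    by unfold_locales
       (use \<open>F \<noteq> {}\<close> b A comm forms in \<open>auto simp: positive_definite_def\<close>)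
  obtain x y where "symplectic_basis n \<omega> x y" "diagonal_frame n x y"
    using ex_diagonal_basis by blast
  then show ?thesis
    using diagonal_frame_form b(3) by (intro exI[of _ x] exI[of _ y]) (simp add: Let_def)
qed

theorem corollary3p7:
  fixes \<omega> :: "'a::real_vector \<Rightarrow> 'a \<Rightarrow> real"
    and n :: nat
    and F :: "('a \<Rightarrow> real) set"
  assumes "symplectic_vector_space n \<omega>"
    and "\<And>f. f \<in> F \<Longrightarrow> quadratic_form f \<and> positive_definite f"
    and "\<And>f g v. f \<in> F \<Longrightarrow> g \<in> F \<Longrightarrow> poisson_bracket \<omega> f g v = 0"
  shows "\<exists>x y :: nat \<Rightarrow> 'a. symplectic_basis n \<omega> x y \<and>
           (\<forall>f\<in>F. \<exists>\<mu> :: nat \<Rightarrow> real. (\<forall>j\<in>{1..n}. \<mu> j > 0) \<and>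
              (\<forall>s t :: nat \<Rightarrow> real.
                 f (\<Sum>j=1..n. s j *\<^sub>R x j + t j *\<^sub>R y j)
                   = (\<Sum>j=1..n. \<mu> j * ((s j)\<^sup>2 + (t j)\<^sup>2))))"
proof (cases "F = {}")
  case True
  \<comment> \<open>Even then a symplectic basis has to be produced; any single inner product yields one.\<close>
  obtain g :: "'a \<Rightarrow> real" where g: "quadratic_form g \<and> positive_definite g"
    using ex_positive_definite_form[OF assms(1)] by blast
  have "poisson_bracket \<omega> g g v = 0" for v
    using assms(1) by (simp add: poisson_bracket_def symplectic_vector_space_def)
  then obtain x y where "symplectic_basis n \<omega> x y"
    using simultaneous_williamson[OF assms(1), of "{g}"] g by auto
  then show ?thesis
    using True by blast
next
  case False
  then show ?thesis
    using simultaneous_williamson[OF assms] by blast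
qed

end
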